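(* Let $X$ be a Markov process on a finite set $\Omega_0$ with intensity matrix $\lambda$. Let $a\subset\Omega_0$ be absorbing and let $\alpha$ be an initial distribution on $\Omega_0$ (a row vector) with $\alpha(i)=0$ for all $i\in a$. For $u\in\mathbb{R}_+$ let $p_{\alpha,a}^u$ be the row vector with entries $p^u_{\alpha,a}(j)=P_\alpha(X_u=j,\ X_v\notin a \text{ for all } v\le u)$, $j\in\Omega_0$. Then $$p_{\alpha,a}^u=\alpha e^{\boldsymbol{\lambda}(a^c)u}=\alpha e^{\lambda u}I_{a^c}.$$
   Context: $\Omega_0$ is a finite set and $X=(X_u)_{u\ge 0}$ is an $\Omega_0$-valued continuous time process (right-continuous, piecewise constant paths) on a measurable space $(\Omega,\mathscr{F})$ with measures $P_i$, $i\in\Omega_0$, such that $P_i(X_0=i)=1$ and under each $P_i$, $X$ is a time-homogeneous Markov process with intensity matrix $\lambda$ (with $-\lambda(i,i)=\sum_{j\ne i}\lambda(i,j)$). $P_\alpha=\sum_i\alpha(i)P_i$. A nonempty subset $a\subset\Omega_0$ is absorbing if $\lambda(i,j)=0$ for all $i\in a$, $j\in a^c=\Omega_0\setminus a$. $\boldsymbol{\lambda}(a^c)$ is the $\Omega_0\times\Omega_0$ matrix whose $(i,j)$ entry is $\lambda(i,j)$ if $i,j\in a^c$ and $0$ otherwise. $I_{a^c}$ is the $\Omega_0\times\Omega_0$ identity matrix with the rows indexed by $a$ set to $0$. *)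

theory Defs
  imports "HOL-Probability.Probability"
begin

text \<open>The finite state space is a type of class \<open>finite\<close>; matrices indexed by it are
  \<open>real ^ 's ^ 's\<close> with \<open>A $ i $ j\<close> the entry in row \<open>i\<close> and column \<open>j\<close>, and row vectors
  act from the left by \<open>v*\<close>.\<close>

text \<open>The library's multiplication and power on \<open>real ^ 's ^ 's\<close> are componentwise, so the
  exponential series is written with iterated matrix products \<open>**\<close>.\<close>

definition mat_exp :: "real ^ 's ^ 's \<Rightarrow> real ^ 's ^ 's::finite" where
  "mat_exp A = (\<Sum>k. (1 / fact k) *\<^sub>R (((**) A) ^^ k) (mat 1))"

definition intensity_matrix :: "real ^ 's ^ 's::finite \<Rightarrow> bool" where
  "intensity_matrix L \<longleftrightarrow>
     (\<forall>i j. i \<noteq> j \<longrightarrow> 0 \<le> L $ i $ j) \<and> (\<forall>i. - (L $ i $ i) = (\<Sum>j\<in>UNIV - {i}. L $ i $ j))"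

definition absorbing :: "real ^ 's ^ 's \<Rightarrow> 's::finite set \<Rightarrow> bool" where
  "absorbing L a \<longleftrightarrow> a \<noteq> {} \<and> (\<forall>i\<in>a. \<forall>j\<in>- a. L $ i $ j = 0)"

definition sub_intensity :: "real ^ 's ^ 's \<Rightarrow> 's::finite set \<Rightarrow> real ^ 's ^ 's" where
  "sub_intensity L b = (\<chi> i j. if i \<in> b \<and> j \<in> b then L $ i $ j else 0)"

definition restricted_id :: "'s::finite set \<Rightarrow> real ^ 's ^ 's" where
  "restricted_id b = (\<chi> i j. if i = j \<and> i \<in> b then 1 else 0)"

definition initial_distribution :: "real ^ 's::finite \<Rightarrow> bool" where
  "initial_distribution \<alpha> \<longleftrightarrow> (\<forall>i. 0 \<le> \<alpha> $ i) \<and> (\<Sum>i\<in>UNIV. \<alpha> $ i) = 1"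

text \<open>Right-continuity with respect to the discrete topology on the state space.\<close>

definition right_continuous_path :: "(real \<Rightarrow> 's) \<Rightarrow> bool" where
  "right_continuous_path x \<longleftrightarrow> (\<forall>u\<ge>0. \<forall>\<^sub>F v in at_right u. x v = x u)"

definition piecewise_constant_path :: "(real \<Rightarrow> 's) \<Rightarrow> bool" where
  "piecewise_constant_path x \<longleftrightarrow>
     (\<forall>T>0. \<exists>n. \<exists>t :: nat \<Rightarrow> real. t 0 = 0 \<and> t n = T \<and>
        (\<forall>k<n. t k < t (Suc k) \<and> (\<exists>c. \<forall>v\<in>{t k<..<t (Suc k)}. x v = c)))"

text \<open>The sigma-algebra generated by \<open>X v\<close>, \<open>0 \<le> v \<le> s\<close>.\<close>

definition natural_filtration ::
    "'w measure \<Rightarrow> (real \<Rightarrow> 'w \<Rightarrow> 's) \<Rightarrow> real \<Rightarrow> 'w measure" where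
  "natural_filtration M X s =
     sigma (space M) {X v -` {j} \<inter> space M | v j. 0 \<le> v \<and> v \<le> s}"

definition transition_function :: "(real \<Rightarrow> real ^ 's ^ 's::finite) \<Rightarrow> bool" where
  "transition_function Q \<longleftrightarrow>
     (\<forall>t\<ge>0. \<forall>i j. 0 \<le> Q t $ i $ j) \<and>
     (\<forall>t\<ge>0. \<forall>i. (\<Sum>j\<in>UNIV. Q t $ i $ j) = 1) \<and>
     Q 0 = mat 1 \<and>
     (\<forall>s\<ge>0. \<forall>t\<ge>0. Q (s + t) = Q s ** Q t)"

text \<open>Under \<open>M\<close>, the process \<open>X\<close> is time-homogeneous Markov: the conditional probability
  of \<open>X (s + t) = j\<close> given the past up to \<open>s\<close> is \<open>Q t $ X s $ j\<close> for a transition function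
  \<open>Q\<close>, and the intensity matrix is the right derivative of \<open>Q\<close> at \<open>0\<close>.\<close>

definition markov_process ::
    "'w measure \<Rightarrow> (real \<Rightarrow> 'w \<Rightarrow> 's::finite) \<Rightarrow> real ^ 's ^ 's \<Rightarrow> bool" where
  "markov_process M X L \<longleftrightarrow>
     (\<exists>Q. transition_function Q \<and> (Q has_vector_derivative L) (at_right 0) \<and>
        (\<forall>s\<ge>0. \<forall>t\<ge>0. \<forall>j. AE \<omega> in M.
           real_cond_exp M (natural_filtration M X s)
             (indicator {\<omega> \<in> space M. X (s + t) \<omega> = j}) \<omega> = Q t $ X s \<omega> $ j))"

text \<open>The measure \<open>\<Sum>i. \<alpha> $ i * P i\<close> on the measurable space \<open>M\<close>.\<close>

definition mixture ::
    "'w measure \<Rightarrow> ('s::finite \<Rightarrow> 'w measure) \<Rightarrow> real ^ 's \<Rightarrow> 'w measure" where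
  "mixture M P \<alpha> =
     measure_of (space M) (sets M) (\<lambda>A. \<Sum>i\<in>UNIV. ennreal (\<alpha> $ i) * emeasure (P i) A)"

lemma emeasure_mixture:
  assumes "\<And>i. sets (P i) = sets M" and "A \<in> sets M"
  shows "emeasure (mixture M P \<alpha>) A = (\<Sum>i\<in>UNIV. ennreal (\<alpha> $ i) * emeasure (P i) A)"
proof (rule emeasure_measure_of[OF mixture_def])
  show "countably_additive (sets (mixture M P \<alpha>))
          (\<lambda>A. \<Sum>i\<in>UNIV. ennreal (\<alpha> $ i) * emeasure (P i) A)"
  proof (rule countably_additiveI)
    fix B :: "nat \<Rightarrow> _"
    assume B: "range B \<subseteq> sets (mixture M P \<alpha>)" "disjoint_family B"
    have "sets (mixture M P \<alpha>) = sets M"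
      by (simp add: mixture_def)
    then have "(\<Sum>n. emeasure (P i) (B n)) = emeasure (P i) (\<Union> (range B))" for i
      using B assms(1) by (intro suminf_emeasure) auto
    then show "(\<Sum>n. \<Sum>i\<in>UNIV. ennreal (\<alpha> $ i) * emeasure (P i) (B n)) =
               (\<Sum>i\<in>UNIV. ennreal (\<alpha> $ i) * emeasure (P i) (\<Union> (range B)))"
      by (subst suminf_sum) auto
  qed
qed (use assms in \<open>auto simp: positive_def mixture_def dest: sets.sets_into_space\<close>)

text \<open>Entry \<open>j\<close> is the probability under \<open>M\<close> that \<open>X u = j\<close> and \<open>X\<close> avoids \<open>a\<close> on \<open>[0, u]\<close>.\<close>

definition avoiding_probs ::
    "'w measure \<Rightarrow> (real \<Rightarrow> 'w \<Rightarrow> 's::finite) \<Rightarrow> 's set \<Rightarrow> real \<Rightarrow> real ^ 's" where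
  "avoiding_probs M X a u =
     (\<chi> j. measure M {\<omega> \<in> space M. X u \<omega> = j \<and> (\<forall>v\<in>{0..u}. X v \<omega> \<notin> a)})"

end

theory Submission
  imports Defs
begin

text \<open>The transition function solves \<open>Q' = L ** Q\<close>, so it is \<open>mat_exp (t *\<^sub>R L)\<close>. Absorption of
  \<open>a\<close> says that \<open>L\<close> and \<open>sub_intensity L (- a)\<close> are intertwined by \<open>restricted_id (- a)\<close>, and
  this carries over to the exponentials; in particular no mass flows from \<open>a\<close> to \<open>- a\<close>. Hence, up
  to a null set, a path that lies outside \<open>a\<close> at time \<open>u\<close> has avoided \<open>a\<close> throughout: right-continuity
  reduces the uncountably many times before \<open>u\<close> to the rational ones.\<close>

section \<open>Matrix products and the exponential series\<close>

lemma bounded_bilinear_matrix_mult: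
  "bounded_bilinear ((**) :: real^'n^'m \<Rightarrow> real^'p^'n \<Rightarrow> real^'p^'m)"
  unfolding bilinear_conv_bounded_bilinear[symmetric] bilinear_def linear_iff
  by (auto simp: matrix_matrix_mult_def vec_eq_iff distrib_left distrib_right
      sum.distrib sum_distrib_left mult.left_commute mult.assoc)

lemmas bounded_linear_matrix_mult_left =
  bounded_bilinear.bounded_linear_left[OF bounded_bilinear_matrix_mult]
lemmas bounded_linear_matrix_mult_right =
  bounded_bilinear.bounded_linear_right[OF bounded_bilinear_matrix_mult]

abbreviation mat_pow :: "real^'s^'s \<Rightarrow> nat \<Rightarrow> real^'s^'s::finite" where
  "mat_pow A k \<equiv> (((**) A) ^^ k) (mat 1)"

text \<open>With \<open>K\<close> a bound for the bilinear matrix product, each further factor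
  \<open>A\<close> costs at most \<open>norm A * K\<close>. The series is therefore dominated by a
  real exponential series, so the sum in \<open>mat_exp\<close> really converges.\<close>

lemma mat_exp_sums: "(\<lambda>k. (1 / fact k) *\<^sub>R mat_pow A k) sums mat_exp A"
proof -
  obtain K where K: "norm (B ** C) \<le> norm B * norm C * K" "K > 0" for B C :: "real^'a^'a"
    using bounded_bilinear.pos_bounded[OF bounded_bilinear_matrix_mult] by blast
  have pow: "norm (mat_pow A k) \<le> (norm A * K) ^ k * norm (mat 1 :: real^'a^'a)" for k
  proof (induction k)
    case (Suc k)
    have "norm (mat_pow A (Suc k)) \<le> (norm A * K) * norm (mat_pow A k)"
      using K(1)[of A "mat_pow A k"] by (simp add: mult_ac)
    also have "\<dots> \<le> (norm A * K) * ((norm A * K) ^ k * norm (mat 1 :: real^'a^'a))"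
      using Suc K(2) by (intro mult_left_mono) auto
    finally show ?case by (simp add: mult_ac)
  qed simp
  have "summable (\<lambda>k. (norm A * K) ^ k /\<^sub>R fact k * norm (mat 1 :: real^'a^'a))"
    by (intro summable_mult2 summable_exp_generic)
  then have "summable (\<lambda>k. (1 / fact k) *\<^sub>R mat_pow A k)"
    by (rule summable_comparison_test'[where N = 0])
       (use pow in \<open>auto simp: field_simps\<close>)
  then show ?thesis
    unfolding mat_exp_def by (rule summable_sums)
qed

lemma mat_pow_scaleR: "mat_pow (c *\<^sub>R A) k = c ^ k *\<^sub>R mat_pow A k"
  by (induction k)
     (simp_all add: bounded_bilinear.scaleR_left[OF bounded_bilinear_matrix_mult]
       bounded_bilinear.scaleR_right[OF bounded_bilinear_matrix_mult] mult.commute)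

text \<open>Moving \<open>R\<close> past one factor at a time turns \<open>A\<close> into
  \<open>B\<close> in every power. Multiplication by \<open>R\<close> is continuous and linear, so
  the relation survives summation.\<close>

lemma mat_exp_intertwine:
  assumes "A ** R = R ** B"
  shows "mat_exp A ** R = R ** mat_exp B"
proof -
  have pow: "mat_pow A k ** R = R ** mat_pow B k" for k
    by (induction k) (simp_all, metis assms matrix_mul_assoc)
  have "(\<lambda>k. ((1 / fact k) *\<^sub>R mat_pow A k) ** R) sums (mat_exp A ** R)"
    by (intro bounded_linear.sums[OF bounded_linear_matrix_mult_left] mat_exp_sums)
  moreover have "(\<lambda>k. R ** ((1 / fact k) *\<^sub>R mat_pow B k)) sums (R ** mat_exp B)"
    by (intro bounded_linear.sums[OF bounded_linear_matrix_mult_right] mat_exp_sums)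
  ultimately show ?thesis
    by (intro sums_unique2[rotated])
       (auto simp: pow bounded_bilinear.scaleR_left[OF bounded_bilinear_matrix_mult]
         bounded_bilinear.scaleR_right[OF bounded_bilinear_matrix_mult])
qed

section \<open>Transition functions and the backward equation\<close>

lemma has_vector_derivative_iff_tendsto:
  "(f has_vector_derivative D) (at x within S) \<longleftrightarrow>
     ((\<lambda>y. (f y - f x) /\<^sub>R (y - x)) \<longlongrightarrow> D) (at x within S)"
proof -
  have eq: "norm (f y - f x - (y - x) *\<^sub>R D) / norm (y - x) =
      norm ((f y - f x) /\<^sub>R (y - x) - D)" if "y \<noteq> x" for y
  proof -
    have "(f y - f x) /\<^sub>R (y - x) - D = (f y - f x - (y - x) *\<^sub>R D) /\<^sub>R (y - x)"
      using that by (simp add: scaleR_right_diff_distrib)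
    then show ?thesis by (simp only: norm_scaleR) (simp add: divide_inverse_commute)
  qed
  have "(f has_vector_derivative D) (at x within S) \<longleftrightarrow>
      ((\<lambda>y. norm (f y - f x - (y - x) *\<^sub>R D) / norm (y - x)) \<longlongrightarrow> 0) (at x within S)"
    by (simp add: has_vector_derivative_def has_derivative_iff_norm bounded_linear_scaleR_left)
  also have "\<dots> \<longleftrightarrow> ((\<lambda>y. norm ((f y - f x) /\<^sub>R (y - x) - D)) \<longlongrightarrow> 0) (at x within S)"
    by (intro filterlim_cong) (auto simp: eventually_at_filter eq intro!: always_eventually simp del: real_norm_def)
  finally show ?thesis
    by (simp add: tendsto_norm_zero_iff LIM_zero_iff)
qed

text \<open>A crude bound from entries in [0, 1]. What matters is that it does not depend on
  \<open>t\<close>.\<close>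

lemma transition_function_norm_le:
  fixes Q :: "real \<Rightarrow> real^'s^'s::finite"
  assumes "transition_function Q" "t \<ge> 0"
  shows "norm (Q t) \<le> real CARD('s) * real CARD('s)"
proof -
  have ent: "norm (Q t $ i $ j) \<le> 1" for i j
  proof -
    have "Q t $ i $ j \<le> (\<Sum>j\<in>UNIV. Q t $ i $ j)"
      using assms by (intro member_le_sum) (auto simp: transition_function_def)
    then show ?thesis
      using assms by (auto simp: transition_function_def)
  qed
  have row: "norm (Q t $ i) \<le> real CARD('s)" for i
    using sum_bounded_above[of UNIV "\<lambda>j. \<bar>Q t $ i $ j\<bar>" 1] ent[of i] norm_le_l1_cart[of "Q t $ i"] by simp
  have "norm (Q t) \<le> (\<Sum>i\<in>UNIV. norm (Q t $ i))"
    unfolding norm_vec_def by (rule L2_set_le_sum) auto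
  also have "\<dots> \<le> real CARD('s) * real CARD('s)"
    using sum_bounded_above[of UNIV "\<lambda>i. norm (Q t $ i)" "real CARD('s)"] row by simp
  finally show ?thesis .
qed

text \<open>By the semigroup law an increment of \<open>Q\<close> factors as
  \<open>Q (y + h) - Q y = (Q h - mat 1) ** Q y\<close>, which reduces differentiability everywhere
  to the derivative at 0. From the right this is immediate; from the left the base point
  \<open>y = x - h\<close> moves, so left-continuity of \<open>Q\<close> has to come first.\<close>

lemma transition_function_has_vector_derivative:
  fixes Q :: "real \<Rightarrow> real^'s^'s::finite"
  assumes Q: "transition_function Q" and L: "(Q has_vector_derivative L) (at_right 0)"
    and x: "x \<ge> 0"
  shows "(Q has_vector_derivative L ** Q x) (at_right x)"
    and "x > 0 \<Longrightarrow> (Q has_vector_derivative L ** Q x) (at x)"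
proof -
  interpret bb: bounded_bilinear "(**) :: real^'s^'s \<Rightarrow> real^'s^'s \<Rightarrow> real^'s^'s"
    by (rule bounded_bilinear_matrix_mult)
  define D where "D h = (Q h - mat 1) /\<^sub>R h" for h
  have D: "(D \<longlongrightarrow> L) (at_right 0)"
    using L Q by (simp add: has_vector_derivative_iff_tendsto D_def[abs_def] transition_function_def)
  have QD: "Q (y + h) - Q y = h *\<^sub>R (D h ** Q y)" if "y \<ge> 0" "h > 0" for y h
  proof -
    have "Q (y + h) = Q h ** Q y"
      using Q that unfolding transition_function_def by (metis add.commute less_imp_le)
    then show ?thesis using that by (simp add: D_def bb.diff_left bb.scaleR_left)
  qed
  show right: "(Q has_vector_derivative L ** Q x) (at_right x)"
    unfolding has_vector_derivative_iff_tendsto filterlim_at_right_to_0[of _ _ x]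
  proof (rule Lim_transform_eventually)
    show "((\<lambda>h. D h ** Q x) \<longlongrightarrow> L ** Q x) (at_right 0)"
      by (intro bb.tendsto D tendsto_const)
    show "\<forall>\<^sub>F h in at_right 0. D h ** Q x = (Q (h + x) - Q x) /\<^sub>R (h + x - x)"
      using QD[OF x] by (auto simp: eventually_at_filter add.commute)
  qed
  assume x0: "x > 0"
  \<comment> \<open>For such \<open>h\<close> the point \<open>x - h\<close> is still nonnegative,
    so \<open>QD\<close> applies with \<open>y = x - h\<close>.\<close>
  have ev: "\<forall>\<^sub>F h in at_right (0::real). 0 < h \<and> h < x"
    using eventually_at_right_less[of 0] eventually_at_right_field x0 by blast
  \<comment> \<open>The increment is \<open>h\<close> times \<open>D h ** Q (x - h)\<close>. Here
    \<open>D h\<close> converges and \<open>Q\<close> is uniformly bounded, so the factor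
    \<open>h\<close> forces the limit 0.\<close>
  have QL: "((\<lambda>h. Q (x - h)) \<longlongrightarrow> Q x) (at_right 0)"
  proof -
    obtain K where K: "norm (B ** C) \<le> norm B * norm C * K" "K > 0" for B C :: "real^'s^'s"
      using bb.pos_bounded by blast
    define C where "C = real CARD('s) * real CARD('s)"
    have "((\<lambda>h. h * (norm (D h) * C * K)) \<longlongrightarrow> 0 * (norm L * C * K)) (at_right 0)"
      by (intro tendsto_intros D)
    then have z: "((\<lambda>h. h * (norm (D h) * C * K)) \<longlongrightarrow> 0) (at_right 0)" by simp
    have "\<forall>\<^sub>F h in at_right 0. norm (Q (x - h) - Q x) \<le> h * (norm (D h) * C * K)"
      using ev
    proof eventually_elim
      case (elim h)
      have "norm (Q (x - h) - Q x) = h * norm (D h ** Q (x - h))"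
        using QD[of "x - h" h] elim by (subst norm_minus_commute) simp
      also have "\<dots> \<le> h * (norm (D h) * norm (Q (x - h)) * K)"
        using elim K by (intro mult_left_mono) auto
      also have "\<dots> \<le> h * (norm (D h) * C * K)"
        using elim K(2) transition_function_norm_le[OF Q, of "x - h"]
        by (intro mult_left_mono mult_right_mono) (auto simp: C_def)
      finally show ?case .
    qed
    then have "((\<lambda>h. Q (x - h) - Q x) \<longlongrightarrow> 0) (at_right 0)"
      by (rule Lim_null_comparison) (rule z)
    then show ?thesis by (rule LIM_zero_cancel)
  qed
  have "(Q has_vector_derivative L ** Q x) (at_left x)"
    \<comment> \<open>Reflection followed by translation parametrises the points left of
      \<open>x\<close> as \<open>- (h + - x)\<close>, that is \<open>x - h\<close>, with
      \<open>h\<close> tending to 0 from the right.\<close>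
    unfolding has_vector_derivative_iff_tendsto filterlim_at_left_to_right filterlim_at_right_to_0[of _ _ "- x"]
  proof (rule Lim_transform_eventually)
    show "((\<lambda>h. D h ** Q (x - h)) \<longlongrightarrow> L ** Q x) (at_right 0)"
      by (intro bb.tendsto D QL)
    show "\<forall>\<^sub>F h in at_right 0. D h ** Q (x - h) =
        (Q (- (h + - x)) - Q x) /\<^sub>R (- (h + - x) - x)"
      using ev
    proof eventually_elim
      case (elim h)
      have "Q (x - h) - Q x = - h *\<^sub>R (D h ** Q (x - h))"
        using QD[of "x - h" h] elim by (simp add: algebra_simps)
      then show ?case using elim by simp
    qed
  qed
  with right show "(Q has_vector_derivative L ** Q x) (at x)"
    unfolding has_vector_derivative_iff_tendsto by (intro filterlim_split_at)
qed

text \<open>Uniqueness for the linear equation is obtained by comparing \<open>Q\<close> directly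
  with the partial sums of the exponential series and showing that the remainder tends to 0.\<close>

lemma transition_function_eq_mat_exp:
  fixes Q :: "real \<Rightarrow> real^'s^'s::finite"
  assumes Q: "transition_function Q" and L: "(Q has_vector_derivative L) (at_right 0)"
    and t: "t \<ge> 0"
  shows "Q t = mat_exp (t *\<^sub>R L)"
proof -
  interpret bb: bounded_bilinear "(**) :: real^'s^'s \<Rightarrow> real^'s^'s \<Rightarrow> real^'s^'s"
    by (rule bounded_bilinear_matrix_mult)
  obtain K where K: "norm (B ** C) \<le> norm B * norm C * K" "K > 0" for B C :: "real^'s^'s"
    using bb.pos_bounded by blast
  \<comment> \<open>\<open>C\<close> bounds the norm of all \<open>Q t\<close> with
    \<open>t \<ge> 0\<close>, and \<open>B\<close> bounds left multiplication by
    \<open>L\<close>.\<close>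
  define C where "C = real CARD('s) * real CARD('s)"
  define B where "B = norm L * K"
  define S where "S n t = (\<Sum>k<n. (t ^ k / fact k) *\<^sub>R mat_pow L k)" for n t
  \<comment> \<open>At 0 only the given right derivative is available, which suffices within
    \<open>{0..}\<close>; at positive times the two-sided derivative is used.\<close>
  have contQ: "continuous_on {0..T} Q" for T
  proof (rule continuous_on_subset[where s = "{0..}"])
    show "continuous_on {0..} Q"
      unfolding continuous_on_eq_continuous_within
    proof
      fix x :: real assume "x \<in> {0..}"
      then consider "x = 0" | "x > 0" by fastforce
      then show "continuous (at x within {0..}) Q"
      proof cases
        case 1
        then show ?thesis
          using has_vector_derivative_continuous[OF L]
          by (simp add: continuous_within at_within_Ici_at_right)
      next
        case 2
        then show ?thesis
          using has_vector_derivative_continuous[OF transition_function_has_vector_derivative(2)[OF Q L, of x]]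
          by (simp add: continuous_at_imp_continuous_at_within)
      qed
    qed
  qed auto
  \<comment> \<open>\<open>S\<close> collects the Taylor polynomials of the exponential; as \<open>(Q - S (Suc n))' = L ** (Q - S n)\<close>,
    the remainder estimate follows by induction, integrating from \<open>0\<close>.\<close>
  have dS: "(S (Suc n) has_vector_derivative L ** S n x) (at x)" for n x
  proof -
    have "((\<lambda>t. \<Sum>k<Suc n. (t ^ k / fact k) *\<^sub>R mat_pow L k) has_vector_derivative
        (\<Sum>k<Suc n. (of_nat k * x ^ (k - 1) / fact k) *\<^sub>R mat_pow L k)) (at x)"
      by (intro has_vector_derivative_sum) (auto intro!: derivative_eq_intros)
    \<comment> \<open>The term for \<open>k = 0\<close> has coefficient 0; after shifting the index,
      one factor \<open>L\<close> comes out of each power.\<close>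
    also have "(\<Sum>k<Suc n. (of_nat k * x ^ (k - 1) / fact k) *\<^sub>R mat_pow L k) = L ** S n x"
      by (subst sum.lessThan_Suc_shift)
         (simp add: S_def bb.sum_right bb.scaleR_right field_simps del: of_nat_Suc)
    finally show ?thesis by (simp add: S_def[abs_def])
  qed
  have bound: "norm (Q t - S n t) \<le> C * B ^ n * t ^ n / fact n" if "t \<ge> 0" for n t
    using that
  proof (induction n arbitrary: t)
    \<comment> \<open>\<open>S 0\<close> is the empty sum, so the induction starts from the uniform
      bound on \<open>Q\<close>.\<close>
    case 0
    then show ?case using transition_function_norm_le[OF Q] by (simp add: S_def C_def)
  next
    case (Suc n)
    show ?case
    \<comment> \<open>The mean value estimate needs a nondegenerate interval. At
      \<open>t = 0\<close> both matrices are \<open>mat 1\<close>.\<close>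
    proof (cases "t = 0")
      case True
      have "S (Suc n) 0 = mat 1"
        unfolding S_def by (subst sum.lessThan_Suc_shift) simp
      then show ?thesis using True Q by (simp add: transition_function_def)
    next
      case False
      with Suc.prems have t: "0 < t" by simp
      have S0: "S (Suc n) 0 = Q 0"
        using Q unfolding S_def by (subst sum.lessThan_Suc_shift) (simp add: transition_function_def)
      have "norm ((Q t - S (Suc n) t) - (Q 0 - S (Suc n) 0)) \<le>
          C * B ^ Suc n * t ^ Suc n / fact (Suc n) - C * B ^ Suc n * 0 ^ Suc n / fact (Suc n)"
      proof (rule differentiable_bound_general[OF t])
        have "continuous_on {0..t} (S (Suc n))"
          unfolding S_def by (intro continuous_intros) auto
        then show "continuous_on {0..t} (\<lambda>t. Q t - S (Suc n) t)"
          by (intro continuous_on_diff contQ)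
        show "continuous_on {0..t} (\<lambda>t. C * B ^ Suc n * t ^ Suc n / fact (Suc n))"
          by (intro continuous_intros) auto
        fix x assume x: "0 < x" "x < t"
        show "((\<lambda>t. Q t - S (Suc n) t) has_vector_derivative L ** (Q x - S n x)) (at x)"
          using x unfolding bb.diff_right
          by (intro has_vector_derivative_diff dS transition_function_has_vector_derivative(2)[OF Q L]) auto
        show "((\<lambda>t. C * B ^ Suc n * t ^ Suc n / fact (Suc n)) has_vector_derivative
            C * B ^ Suc n * x ^ n / fact n) (at x)"
          using DERIV_cmult[OF DERIV_pow[of "Suc n" x], of "C * B ^ Suc n / fact (Suc n)"]
          unfolding has_real_derivative_iff_has_vector_derivative[symmetric]
          by (simp add: mult.assoc del: of_nat_Suc power_Suc)
        have "norm (L ** (Q x - S n x)) \<le> B * norm (Q x - S n x)"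
          using K(1)[of L "Q x - S n x"] by (simp add: B_def mult_ac)
        also have "\<dots> \<le> B * (C * B ^ n * x ^ n / fact n)"
          using Suc.IH[of x] x K(2) by (intro mult_left_mono) (auto simp: B_def)
        finally show "norm (L ** (Q x - S n x)) \<le> C * B ^ Suc n * x ^ n / fact n"
          by (simp add: mult_ac)
      qed
      then show ?thesis by (simp add: S0)
    qed
  qed
  \<comment> \<open>Up to the factor \<open>C\<close>, the remainder bound is the general term of a
    convergent exponential series.\<close>
  have "(\<lambda>n. (B * t) ^ n /\<^sub>R fact n) \<longlonglongrightarrow> 0"
    by (intro summable_LIMSEQ_zero summable_exp_generic)
  then have "(\<lambda>n. C * ((B * t) ^ n /\<^sub>R fact n)) \<longlonglongrightarrow> C * 0"
    by (intro tendsto_mult_left)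
  then have lim: "(\<lambda>n. C * B ^ n * t ^ n / fact n) \<longlonglongrightarrow> 0"
    by (simp add: field_simps)
  have "(\<lambda>n. Q t - S n t) \<longlonglongrightarrow> 0"
    by (rule Lim_null_comparison[OF always_eventually lim]) (use bound[OF t] in blast)
  then have "(\<lambda>n. Q t - (Q t - S n t)) \<longlonglongrightarrow> Q t - 0"
    by (intro tendsto_diff tendsto_const)
  then have "(\<lambda>n. S n t) \<longlonglongrightarrow> Q t"
    by simp
  moreover have "(\<lambda>n. S n t) \<longlonglongrightarrow> mat_exp (t *\<^sub>R L)"
    using mat_exp_sums[of "t *\<^sub>R L"] by (simp add: sums_def S_def mat_pow_scaleR)
  ultimately show ?thesis by (rule LIMSEQ_unique)
qed

section \<open>Absorption, joint laws and the avoidance event\<close>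

lemma restricted_id_nth:
  "restricted_id b $ i $ j = (if i = j then if j \<in> b then 1 else 0 else 0)"
  by (simp add: restricted_id_def)

lemma matrix_mult_restricted_id_nth:
  "(A ** restricted_id b) $ i $ j = (if j \<in> b then A $ i $ j else 0)"
  "(restricted_id b ** A) $ i $ j = (if i \<in> b then A $ i $ j else 0)"
  by (simp_all add: matrix_matrix_mult_def restricted_id_nth
      if_distrib[of "\<lambda>x. _ * x"] if_distrib[of "\<lambda>x. x * _"] cong: if_cong)

text \<open>Both sides keep only columns outside \<open>a\<close>. On the left the rows in
  \<open>a\<close> remain, and absorption is what makes them vanish there.\<close>

lemma absorbing_intertwine:
  assumes "absorbing L a"
  shows "L ** restricted_id (- a) = restricted_id (- a) ** sub_intensity L (- a)"
  using assms
  by (auto simp: vec_eq_iff matrix_mult_restricted_id_nth sub_intensity_def absorbing_def)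

lemma vector_matrix_mult_restricted_id:
  assumes "\<And>i. i \<in> a \<Longrightarrow> \<alpha> $ i = 0"
  shows "\<alpha> v* restricted_id (- a) = \<alpha>"
  using assms
  by (auto simp: vec_eq_iff vector_matrix_mult_def restricted_id_nth
      if_distrib[of "\<lambda>x. _ * x"] if_distrib[of "\<lambda>x. x * _"] cong: if_cong)

text \<open>The event \<open>X s = k\<close> belongs to the past up to \<open>s\<close>, so the
  conditional probability may be integrated over it; on that event it is the constant
  \<open>Q $ k $ j\<close>.\<close>

lemma (in prob_space) markov_joint_prob:
  fixes X :: "real \<Rightarrow> 'a \<Rightarrow> 's::finite"
  assumes X: "\<And>v. 0 \<le> v \<Longrightarrow> X v \<in> M \<rightarrow>\<^sub>M count_space UNIV"
    and cond: "AE \<omega> in M. real_cond_exp M (natural_filtration M X s)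
        (indicator {\<omega> \<in> space M. X (s + t) \<omega> = j}) \<omega> = Q $ X s \<omega> $ j"
    and s: "0 \<le> s" and t: "0 \<le> t"
  shows "prob {\<omega> \<in> space M. X s \<omega> = k \<and> X (s + t) \<omega> = j} =
    Q $ k $ j * prob {\<omega> \<in> space M. X s \<omega> = k}"
proof -
  note [measurable] = X[OF s] X[OF add_nonneg_nonneg[OF s t]]
  let ?F = "natural_filtration M X s"
  let ?G = "{X v -` {j} \<inter> space M | v j. 0 \<le> v \<and> v \<le> s}"
  let ?A = "{\<omega> \<in> space M. X s \<omega> = k}" and ?B = "{\<omega> \<in> space M. X (s + t) \<omega> = j}"
  have G: "?G \<subseteq> sets M"
    using X by (auto intro: measurable_sets)
  then have G': "?G \<subseteq> Pow (space M)"
    using sets.space_closed by blast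
  have "subalgebra M ?F"
    using G G' unfolding subalgebra_def natural_filtration_def
    by (simp add: space_measure_of sets_measure_of sets.sigma_sets_subset)
  then interpret F: finite_measure_subalgebra M ?F
    by unfold_locales
  have A: "?A \<in> sets ?F"
  proof -
    have "?A = X s -` {k} \<inter> space M" by auto
    then have "?A \<in> ?G" using s by blast
    then show ?thesis
      unfolding natural_filtration_def sets_measure_of[OF G'] by (rule sigma_sets.Basic)
  qed
  have B: "?B \<in> sets M" and A': "?A \<in> sets M" by measurable
  have "prob {\<omega> \<in> space M. X s \<omega> = k \<and> X (s + t) \<omega> = j} = prob (?A \<inter> ?B)"
    by (rule arg_cong[where f = prob]) auto
  also have "\<dots> = (\<integral>\<omega>\<in>?A. indicator ?B \<omega> \<partial>M)"
    using A' B by (simp add: set_lebesgue_integral_def flip: indicator_inter_arith)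
  also have "\<dots> = (\<integral>\<omega>\<in>?A. real_cond_exp M ?F (indicator ?B) \<omega> \<partial>M)"
    by (intro F.real_cond_exp_intA A integrable_real_indicator B) (simp add: emeasure_eq_measure)
  also have "\<dots> = (\<integral>\<omega>. Q $ k $ j * indicator ?A \<omega> \<partial>M)"
    unfolding set_lebesgue_integral_def
  proof (rule integral_cong_AE)
    show "AE \<omega> in M. indicator ?A \<omega> *\<^sub>R real_cond_exp M ?F (indicator ?B) \<omega> = Q $ k $ j * indicator ?A \<omega>"
      using cond by eventually_elim (auto simp: indicator_def)
  qed (use A' in measurable)
  also have "\<dots> = Q $ k $ j * prob ?A"
    using A' by simp
  finally show ?thesis .
qed

text \<open>A visit to \<open>a\<close> at a time \<open>v < u\<close> lasts for a while by
  right-continuity, hence is seen at a rational time before \<open>u\<close>. The endpoint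
  \<open>u\<close> is listed separately because a visit starting there has no later time in
  range.\<close>

lemma avoiding_event_eq:
  assumes "right_continuous_path x" "0 \<le> u"
  shows "(\<forall>v\<in>{0..u}. x v \<notin> a) \<longleftrightarrow> (\<forall>v\<in>insert u (\<rat> \<inter> {0..u}). x v \<notin> a)"
proof (intro iffI ballI notI)
  fix v assume rat: "\<forall>v\<in>insert u (\<rat> \<inter> {0..u}). x v \<notin> a" and v: "v \<in> {0..u}" "x v \<in> a"
  then have "v < u" by (cases "v = u") auto
  have "\<forall>\<^sub>F w in at_right v. x w = x v"
    using assms v by (auto simp: right_continuous_path_def)
  then obtain b where b: "b > v" "\<And>w. v < w \<Longrightarrow> w < b \<Longrightarrow> x w = x v"
    unfolding eventually_at_right_field by blast
  obtain q where "q \<in> \<rat>" "v < q" "q < min b u"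
    using Rats_dense_in_real[of v "min b u"] b \<open>v < u\<close> by auto
  then have "q \<in> \<rat> \<inter> {0..u}" "x q \<in> a" using b(2)[of q] v by auto
  then show False using rat by blast
qed (use assms in auto)


section \<open>The avoidance probabilities\<close>

theorem proposition4p1:
  fixes M :: "'w measure"
    and P :: "'s::finite \<Rightarrow> 'w measure"
    and X :: "real \<Rightarrow> 'w \<Rightarrow> 's"
    and L :: "real ^ 's ^ 's"
    and a :: "'s set"
    and \<alpha> :: "real ^ 's"
    and u :: real
  assumes X_measurable: "\<And>v. 0 \<le> v \<Longrightarrow> X v \<in> M \<rightarrow>\<^sub>M count_space UNIV"
    and X_paths: "\<And>\<omega>. \<omega> \<in> space M \<Longrightarrow>
      right_continuous_path (\<lambda>v. X v \<omega>) \<and> piecewise_constant_path (\<lambda>v. X v \<omega>)"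
    and P_prob: "\<And>i. prob_space (P i)"
    and P_sets: "\<And>i. sets (P i) = sets M"
    and P_start: "\<And>i. measure (P i) {\<omega> \<in> space M. X 0 \<omega> = i} = 1"
    and L_intensity: "intensity_matrix L"
    and X_markov: "\<And>i. markov_process (P i) X L"
    and a_absorbing: "absorbing L a"
    and \<alpha>_initial: "initial_distribution \<alpha>"
    and \<alpha>_a: "\<And>i. i \<in> a \<Longrightarrow> \<alpha> $ i = 0"
    and u_nonneg: "0 \<le> u"
  shows "avoiding_probs (mixture M P \<alpha>) X a u = \<alpha> v* mat_exp (u *\<^sub>R sub_intensity L (- a)) \<and>
         \<alpha> v* mat_exp (u *\<^sub>R sub_intensity L (- a)) =
           \<alpha> v* (mat_exp (u *\<^sub>R L) ** restricted_id (- a))"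
proof -
  let ?R = "restricted_id (- a)"
  let ?E = "\<lambda>t. mat_exp (t *\<^sub>R L)"
  interpret bb: bounded_bilinear "(**) :: real^'s^'s \<Rightarrow> real^'s^'s \<Rightarrow> real^'s^'s"
    by (rule bounded_bilinear_matrix_mult)
  have inter: "?E t ** ?R = ?R ** mat_exp (t *\<^sub>R sub_intensity L (- a))" for t
    using absorbing_intertwine[OF a_absorbing]
    by (intro mat_exp_intertwine) (simp add: bb.scaleR_left bb.scaleR_right)
  \<comment> \<open>Multiplying by \<open>?R\<close> on the right leaves column \<open>j\<close>
    unchanged, while the intertwined form has a zero row \<open>k\<close>.\<close>
  have zero: "?E t $ k $ j = 0" if "k \<in> a" "j \<notin> a" for t k j
  proof -
    have "?E t $ k $ j = (?E t ** ?R) $ k $ j"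
      using that by (simp add: matrix_mult_restricted_id_nth)
    also have "\<dots> = 0"
      using that by (simp add: inter matrix_mult_restricted_id_nth)
    finally show ?thesis .
  qed
  have sp: "space (P i) = space M" for i
    using P_sets by (rule sets_eq_imp_space_eq)
  have sm: "sets (mixture M P \<alpha>) = sets M" "space (mixture M P \<alpha>) = space M"
    by (simp_all add: mixture_def)
  have PX: "X v \<in> P i \<rightarrow>\<^sub>M count_space UNIV" if "0 \<le> v" for v i
    using X_measurable[OF that] measurable_cong_sets[OF P_sets refl] by blast
  \<comment> \<open>The transition function in \<open>markov_process\<close> may a priori differ
    from one \<open>P i\<close> to another; its identification with the exponential makes the
    formula uniform in \<open>i\<close>.\<close>
  have joint: "measure (P i) {\<omega> \<in> space M. X s \<omega> = k \<and> X (s + t) \<omega> = j} =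
      ?E t $ k $ j * measure (P i) {\<omega> \<in> space M. X s \<omega> = k}" if st: "0 \<le> s" "0 \<le> t" for i s t k j
  proof -
    interpret prob_space "P i" by (rule P_prob)
    from X_markov[of i] obtain Q where Q: "transition_function Q" "(Q has_vector_derivative L) (at_right 0)"
      and cond: "AE \<omega> in P i. real_cond_exp (P i) (natural_filtration (P i) X s)
             (indicator {\<omega> \<in> space (P i). X (s + t) \<omega> = j}) \<omega> = Q t $ X s \<omega> $ j"
      unfolding markov_process_def using st by blast
    from markov_joint_prob[OF PX cond st, of k] show ?thesis
      by (simp add: sp transition_function_eq_mat_exp[OF Q st(2)])
  qed
  have meas: "{\<omega> \<in> space M. X v \<omega> \<in> A} \<in> sets M" if "0 \<le> v" for v A
    using measurable_sets[OF X_measurable[OF that], of A] by (simp add: vimage_def Int_def conj_commute)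
  \<comment> \<open>This is \<open>joint\<close> at \<open>s = 0\<close> and \<open>k = i\<close>,
    since \<open>X\<close> starts in \<open>i\<close> almost surely under
    \<open>P i\<close>.\<close>
  have marginal: "measure (P i) {\<omega> \<in> space M. X u \<omega> = j} = ?E u $ i $ j" for i j
  proof -
    interpret prob_space "P i" by (rule P_prob)
    have X0: "{\<omega> \<in> space M. X 0 \<omega> = i} \<in> sets M" and Xu: "{\<omega> \<in> space M. X u \<omega> = j} \<in> sets M"
      using meas[of 0 "{i}"] meas[of u "{j}"] u_nonneg by simp_all
    have "AE \<omega> in P i. \<omega> \<in> {\<omega> \<in> space M. X 0 \<omega> = i}"
      using P_start X0 by (subst prob_eq_1[symmetric]) (simp_all add: P_sets)
    then have "prob {\<omega> \<in> space M. X u \<omega> = j} = prob {\<omega> \<in> space M. X 0 \<omega> = i \<and> X (0 + u) \<omega> = j}"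
      using Xu sets.sets_Collect_conj[OF Xu X0]
      by (intro finite_measure_eq_AE) (auto simp: P_sets elim: eventually_mono)
    then show ?thesis
      using joint[of 0 u i i j] u_nonneg P_start by (simp add: sp)
  qed
  have entry: "measure (mixture M P \<alpha>) {\<omega> \<in> space M. X u \<omega> = j \<and> (\<forall>v\<in>{0..u}. X v \<omega> \<notin> a)} =
      (\<Sum>i\<in>UNIV. \<alpha> $ i * ?E u $ i $ j)" (is "measure _ ?S = _") if j: "j \<notin> a" for j
  proof -
    let ?I = "insert u (\<rat> \<inter> {0..u})"
    have cI: "countable ?I"
      using countable_rat by auto
    \<comment> \<open>The countable description serves twice: it makes the event measurable, and it
      allows countably many null sets to be discarded.\<close>
    have S_eq: "?S = {\<omega> \<in> space M. X u \<omega> = j \<and> (\<forall>v\<in>?I. X v \<omega> \<notin> a)}"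
      by (rule Collect_cong) (use X_paths avoiding_event_eq[OF _ u_nonneg] in metis)
    have Xu: "{\<omega> \<in> space M. X u \<omega> = j} \<in> sets M"
      using meas[of u "{j}"] u_nonneg by simp
    have S: "?S \<in> sets M"
    proof -
      have "{\<omega> \<in> space M. X v \<omega> \<notin> a} \<in> sets M" if "v \<in> ?I" for v
        using meas[of v "- a"] that u_nonneg by auto
      then have "{\<omega> \<in> space M. \<forall>v\<in>?I. X v \<omega> \<notin> a} \<in> sets M"
        using cI by (rule sets.sets_Collect_countable_All')
      from sets.sets_Collect_conj[OF this Xu] show ?thesis
        unfolding S_eq .
    qed
    have PS: "measure (P i) ?S = ?E u $ i $ j" for i
    proof -
      interpret prob_space "P i" by (rule P_prob)
      \<comment> \<open>By \<open>joint\<close> with time step \<open>u - q\<close>, the exceptional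
        event has a probability containing the factor \<open>?E (u - q) $ k $ j\<close>, which is 0
        by \<open>zero\<close>.\<close>
      have "AE \<omega> in P i. \<not> (X q \<omega> = k \<and> X u \<omega> = j)" if q: "q \<in> ?I" and k: "k \<in> a" for q k
      proof -
        have "{\<omega> \<in> space M. X q \<omega> = k \<and> X u \<omega> = j} \<in> sets M"
          using sets.sets_Collect_conj[OF Xu meas[of q "{k}"]] q u_nonneg by auto
        then have "{\<omega> \<in> space M. X q \<omega> = k \<and> X u \<omega> = j} \<in> null_sets (P i)"
          using joint[of q "u - q" i k j] zero[OF k j] q u_nonneg
          by (auto simp: null_sets_def emeasure_eq_measure P_sets)
        then show ?thesis
          by (rule AE_I') (auto simp: sp)
      qed
      then have "AE \<omega> in P i. \<forall>q\<in>?I. \<forall>k\<in>a. \<not> (X q \<omega> = k \<and> X u \<omega> = j)"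
        by (intro AE_ball_countable' cI countable_finite finite)
      then have "AE \<omega> in P i. \<omega> \<in> ?S \<longleftrightarrow> \<omega> \<in> {\<omega> \<in> space M. X u \<omega> = j}"
        unfolding S_eq by eventually_elim (use j in auto)
      then have "prob ?S = prob {\<omega> \<in> space M. X u \<omega> = j}"
        by (rule finite_measure_eq_AE) (simp_all only: P_sets S Xu)
      then show ?thesis by (simp only: marginal)
    qed
    have nonneg: "0 \<le> \<alpha> $ i * measure (P i) ?S" for i
      using \<alpha>_initial by (simp add: initial_distribution_def)
    have "emeasure (mixture M P \<alpha>) ?S = (\<Sum>i\<in>UNIV. ennreal (\<alpha> $ i) * emeasure (P i) ?S)"
      by (rule emeasure_mixture[OF P_sets S])
    also have "\<dots> = (\<Sum>i\<in>UNIV. ennreal (\<alpha> $ i * measure (P i) ?S))"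
    proof (rule sum.cong[OF refl])
      fix i
      interpret prob_space "P i" by (rule P_prob)
      show "ennreal (\<alpha> $ i) * emeasure (P i) ?S = ennreal (\<alpha> $ i * prob ?S)"
        unfolding emeasure_eq_measure using \<alpha>_initial
        by (intro ennreal_mult[symmetric] measure_nonneg) (simp add: initial_distribution_def)
    qed
    also have "\<dots> = ennreal (\<Sum>i\<in>UNIV. \<alpha> $ i * measure (P i) ?S)"
      by (intro sum_ennreal nonneg)
    finally have "measure (mixture M P \<alpha>) ?S = (\<Sum>i\<in>UNIV. \<alpha> $ i * measure (P i) ?S)"
      by (rule measure_eq_emeasure_eq_ennreal[rotated]) (intro sum_nonneg nonneg)
    then show ?thesis by (simp only: PS)
  qed
  have "avoiding_probs (mixture M P \<alpha>) X a u $ j = (\<alpha> v* (?E u ** ?R)) $ j" for j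
  proof (cases "j \<in> a")
    case True
    \<comment> \<open>Avoidance includes the time \<open>v = u\<close>, which contradicts
      \<open>X u\<close> lying in \<open>a\<close>.\<close>
    then have empty: "{\<omega> \<in> space M. X u \<omega> = j \<and> (\<forall>v\<in>{0..u}. X v \<omega> \<notin> a)} = {}"
      using u_nonneg by auto
    show ?thesis
      unfolding avoiding_probs_def sm vec_lambda_beta empty
      using True by (simp add: vector_matrix_mult_def matrix_mult_restricted_id_nth)
  next
    case False
    then show ?thesis
      unfolding avoiding_probs_def sm vec_lambda_beta entry[OF False]
      by (simp add: vector_matrix_mult_def matrix_mult_restricted_id_nth mult.commute)
  qed
  then have "avoiding_probs (mixture M P \<alpha>) X a u = \<alpha> v* (?E u ** ?R)"
    by (simp add: vec_eq_iff)
  \<comment> \<open>Intertwining moves \<open>?R\<close> to the left of the exponential, where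
    \<alpha> absorbs it because \<alpha> vanishes on \<open>a\<close>.\<close>
  moreover have "\<alpha> v* (?E u ** ?R) = \<alpha> v* mat_exp (u *\<^sub>R sub_intensity L (- a))"
    using vector_matrix_mult_restricted_id[OF \<alpha>_a]
    by (simp add: inter flip: vector_matrix_mul_assoc)
  ultimately show ?thesis by simp
qed

end
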